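(* For every real $k>0$ and every integer $m\ge 1$, $$\int_0^k x^m\psi_k(x)\,dx=\frac{k^m(\ln k-\gamma)}{m+1}-\frac{k^m}{m}+k^m\sum_{s=2}^\infty\frac{(-1)^s}{m+s}\,\zeta(s).$$
   Context: For $k>0$ and $x>0$, the $k$-gamma function is $\Gamma_k(x)=\int_0^\infty t^{x-1}e^{-t^k/k}\,dt$, and the $k$-digamma function is $\psi_k(x)=\frac{d}{dx}\ln\Gamma_k(x)$. Here $\gamma$ is the Euler–Mascheroni constant and $\zeta$ is the Riemann zeta function. *)

theory Defs
  imports "HOL-Analysis.Analysis"
begin

text \<open>The parameter \<open>k\<close> and the argument \<open>x\<close> are meant to be positive;
  values outside that range carry no meaning.\<close>

definition Gamma_k :: "real \<Rightarrow> real \<Rightarrow> real" where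
  "Gamma_k k x = integral {0<..} (\<lambda>t. t powr (x - 1) * exp (- (t powr k) / k))"

definition Digamma_k :: "real \<Rightarrow> real \<Rightarrow> real" where
  "Digamma_k k x = deriv (\<lambda>y. ln (Gamma_k k y)) x"

text \<open>The Riemann zeta function on the real half-line \<open>s > 1\<close>, where it is given by
  its Dirichlet series. No analytic continuation is modelled. The summation index is
  shifted because \<^const>\<open>suminf\<close> starts at 0.\<close>

definition zeta :: "real \<Rightarrow> real" where
  "zeta s = (\<Sum>n. 1 / real (n + 1) powr s)"

end

theory Submission
  imports Defs
begin

text \<open>
  The substitution \<open>v = t\<^sup>k / k\<close> gives \<open>\<Gamma>\<^sub>k(x) = k\<^bsup>x/k - 1\<^esup> \<Gamma>(x/k)\<close>, hence
  \<open>\<psi>\<^sub>k(x) = (ln k + \<psi>(x/k)) / k\<close>, and rescaling reduces the claim to the integral of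
  \<open>u\<^sup>m \<psi>(u) = u\<^sup>m \<psi>(1 + u) - u\<^bsup>m - 1\<^esup>\<close> over \<open>[0, 1]\<close>. The Taylor
  series \<open>\<psi>(1 + u) = - \<gamma> + \<Sum>\<^bsub>s \<ge> 2\<^esub> (-1)\<^sup>s \<zeta>(s) u\<^bsup>s - 1\<^esup>\<close> diverges at \<open>u = 1\<close>, but its
  \<open>N\<close>-th remainder is bounded by \<open>\<zeta>(2) u\<^bsup>N + 1\<^esup>\<close> on the whole interval, and the integral of
  this bound tends to \<open>0\<close>.
\<close>

section \<open>Reduction to the classical gamma and digamma functions\<close>

lemma Gamma_k_conv_Gamma:
  assumes k: "k > 0" and x: "x > 0"
  shows "Gamma_k k x = k powr (x / k - 1) * Gamma (x / k)"
proof -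
  define f :: "real \<Rightarrow> real" where "f = (\<lambda>v. v powr (x / k - 1) / exp v)"
  define g where "g = (\<lambda>t::real. t powr k / k)"
  have z: "x / k > 0" using assms by simp
  have f_Ici: "(f has_integral Gamma (x / k)) {0..}"
    unfolding f_def by (rule Gamma_integral_real[OF z])
  \<comment> \<open>The Euler integral is known on the closed half-line; dropping the null set
    \<open>{0}\<close> matches the domain in \<open>Gamma_k\<close>.\<close>
  have f_int: "(f has_integral Gamma (x / k)) {0<..}"
  proof (subst has_integral_spike_set_eq[of _ "{0..}"])
    show "negligible {x \<in> {0<..} - {0..}. f x \<noteq> 0}"
      by (rule negligible_subset[of "{0}"]) auto
    show "negligible {x \<in> {0..} - {0<..}. f x \<noteq> 0}"
      by (rule negligible_subset[of "{0}"]) auto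
  qed (rule f_Ici)
  have f_abs: "f absolutely_integrable_on {0<..}"
    by (rule nonnegative_absolutely_integrable_1) (use f_int in \<open>auto simp: f_def\<close>)
  have bij: "g ` {0<..} = {0<..}"
  proof (intro equalityI subsetI)
    fix v :: real assume v: "v \<in> {0<..}"
    have "g ((k * v) powr (1 / k)) = v"
      using k v by (simp add: g_def powr_powr)
    moreover have "(k * v) powr (1 / k) \<in> {0<..}" using k v by simp
    ultimately show "v \<in> g ` {0<..}" by (metis imageI)
  qed (use k in \<open>auto simp: g_def\<close>)
  have inj: "inj_on g {0<..}"
  proof (rule inj_onI)
    fix a b :: real assume "a \<in> {0<..}" "b \<in> {0<..}" "g a = g b"
    then have "(a powr k) powr (1 / k) = (b powr k) powr (1 / k)" using k by (simp add: g_def)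
    then show "a = b" using k \<open>a \<in> _\<close> \<open>b \<in> _\<close> by (simp add: powr_powr)
  qed
  have der: "(g has_field_derivative t powr (k - 1)) (at t within {0<..})" if "t \<in> {0<..}" for t
    unfolding g_def using that k by (auto intro!: derivative_eq_intros simp: field_simps)
  have "integral {0<..} (\<lambda>t. \<bar>t powr (k - 1)\<bar> * f (g t)) = Gamma (x / k)"
    using has_absolute_integral_change_of_variables_1'[of "{0<..}" g "\<lambda>t. t powr (k - 1)" f
        "Gamma (x / k)"] der inj f_abs f_int
    by (auto simp: bij dest: integral_unique)
  moreover have "t powr (x - 1) * exp (- (t powr k) / k)
      = k powr (x / k - 1) * (\<bar>t powr (k - 1)\<bar> * f (g t))" if "t \<in> {0<..}" for t
  proof -
    have "f (g t) = t powr (k * (x / k - 1)) / k powr (x / k - 1) * exp (- (t powr k) / k)"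
      using that k by (simp add: f_def g_def powr_divide powr_powr exp_minus field_simps)
    \<comment> \<open>The exponent is \<open>x - k = (x - 1) - (k - 1)\<close>, so the Jacobian
      \<open>t powr (k - 1)\<close> cancels.\<close>
    also have "t powr (k * (x / k - 1)) = t powr (x - 1) / t powr (k - 1)"
      using k that by (simp add: powr_diff [symmetric] algebra_simps)
    finally show ?thesis using that k by simp
  qed
  ultimately show ?thesis
    unfolding Gamma_k_def by (simp only: integral_mult_right cong: integral_cong)
qed

lemma Digamma_k_conv_Digamma:
  assumes k: "k > 0" and x: "x > 0"
  shows "Digamma_k k x = (ln k + Digamma (x / k)) / k"
proof -
  have "ln (Gamma_k k y) = (y / k - 1) * ln k + ln_Gamma (y / k)" if "y \<in> {0<..}" for y
    using that k Gamma_real_pos[of "y / k"]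
    by (simp add: Gamma_k_conv_Gamma ln_mult ln_powr ln_Gamma_real_pos less_imp_neq[THEN not_sym])
  moreover have "((\<lambda>y. (y / k - 1) * ln k + ln_Gamma (y / k)) has_field_derivative
      (ln k + Digamma (x / k)) / k) (at x)"
    using assms by (auto intro!: derivative_eq_intros simp: field_simps)
  \<comment> \<open>The closed form is known only for positive \<open>y\<close>, but the derivative
    depends only on a neighbourhood of \<open>x\<close>.\<close>
  ultimately have "((\<lambda>y. ln (Gamma_k k y)) has_field_derivative (ln k + Digamma (x / k)) / k) (at x)"
    using x by (subst has_field_derivative_cong_ev[OF refl _ refl refl])
      (auto intro!: eventually_mono[OF eventually_nhds_in_open[of "{0<..}"]])
  then show ?thesis unfolding Digamma_k_def by (rule DERIV_imp_deriv)
qed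

section \<open>Zeta values and the Taylor remainder of the digamma function\<close>

lemma zeta_sums: "(\<lambda>n. 1 / real (Suc n) ^ (s + 2)) sums zeta (real (s + 2))"
proof -
  have "summable (\<lambda>n. 1 / real (Suc n) ^ (s + 2))"
    using inverse_power_summable[where s = "s + 2" and 'a = real, THEN iffD2[OF summable_Suc_iff]]
    by (simp only: inverse_eq_divide le_add2)
  moreover have "zeta (real (s + 2)) = (\<Sum>n. 1 / real (Suc n) ^ (s + 2))"
    unfolding zeta_def by (simp add: powr_realpow del: of_nat_Suc of_nat_add power_Suc)
  ultimately show ?thesis by (simp add: sums_iff)
qed

text \<open>Up to the factor \<open>(-1) ^ N * u ^ (N + 1)\<close>, this is the remainder of the
  Taylor series of \<open>Digamma (1 + u)\<close> at \<open>u = 0\<close> after \<open>N\<close>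
  zeta terms.\<close>

definition digamma_rem :: "nat \<Rightarrow> real \<Rightarrow> real" where
  "digamma_rem N u = (\<Sum>n. 1 / (real (Suc n) ^ (N + 1) * (real (Suc n) + u)))"

text \<open>Since \<open>Suc n\<close> is at least 1, one majorant serves all \<open>N\<close> and
  all \<open>u \<ge> 0\<close>. The exponent \<open>0 + 2\<close> fits \<open>zeta_sums\<close> at
  \<open>s = 0\<close>.\<close>

lemma digamma_rem_term_le:
  assumes "u \<ge> 0"
  shows "1 / (real (Suc n) ^ (N + 1) * (real (Suc n) + u)) \<le> 1 / real (Suc n) ^ (0 + 2)"
proof -
  have "real (Suc n) ^ 1 * real (Suc n) \<le> real (Suc n) ^ (N + 1) * (real (Suc n) + u)"
    using assms by (intro mult_mono power_increasing) auto
  then show ?thesis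
    by (intro divide_left_mono) (use assms in \<open>auto simp: power2_eq_square\<close>)
qed

lemma summable_digamma_rem:
  assumes "u \<ge> 0"
  shows "summable (\<lambda>n. 1 / (real (Suc n) ^ (N + 1) * (real (Suc n) + u)))"
  by (rule summable_comparison_test'[OF sums_summable[OF zeta_sums[of 0]], of 0])
    (use digamma_rem_term_le[OF assms] assms in auto)

lemma digamma_rem_bounds:
  assumes "u \<ge> 0"
  shows "0 \<le> digamma_rem N u" "digamma_rem N u \<le> zeta 2"
proof -
  show "0 \<le> digamma_rem N u"
    unfolding digamma_rem_def using assms by (intro suminf_nonneg summable_digamma_rem) auto
  have "digamma_rem N u \<le> zeta (real (0 + 2))"
    unfolding digamma_rem_def sums_unique[OF zeta_sums]
    using assms by (intro suminf_le summable_digamma_rem digamma_rem_term_le sums_summable[OF zeta_sums])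
  then show "digamma_rem N u \<le> zeta 2" by simp
qed

text \<open>With \<open>a = Suc n\<close>, this is one step of the geometric expansion,
  \<open>1 / (a + u) = 1 / a - u / (a * (a + u))\<close>, divided by \<open>a ^ (N + 1)\<close> and
  summed over \<open>n\<close>.\<close>

lemma digamma_rem_Suc:
  assumes "u \<ge> 0"
  shows "digamma_rem N u = zeta (real (N + 2)) - u * digamma_rem (Suc N) u"
proof -
  have "(\<lambda>n. 1 / real (Suc n) ^ (N + 2) - u * (1 / (real (Suc n) ^ (Suc N + 1) * (real (Suc n) + u))))
      sums (zeta (real (N + 2)) - u * digamma_rem (Suc N) u)"
    unfolding digamma_rem_def
    by (intro sums_diff sums_mult zeta_sums summable_sums summable_digamma_rem assms)
  moreover have "1 / real (Suc n) ^ (N + 2) - u * (1 / (real (Suc n) ^ (Suc N + 1) * (real (Suc n) + u)))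
      = 1 / (real (Suc n) ^ (N + 1) * (real (Suc n) + u))" for n
  proof -
    have "1 / (a * a ^ (N + 1)) - u * (1 / (a * a ^ (N + 1) * (a + u))) = 1 / (a ^ (N + 1) * (a + u))"
      if "a > 0" for a
      using that assms by (simp add: divide_simps del: power_Suc)
    from this[of "real (Suc n)"] show ?thesis by (simp add: mult_ac)
  qed
  ultimately show ?thesis unfolding digamma_rem_def[of N] by (simp add: sums_iff)
qed

text \<open>In the defining series of \<open>Digamma (1 + u)\<close>, each difference of reciprocals
  is put over a common denominator.\<close>

lemma Digamma_conv_digamma_rem:
  assumes "u \<ge> 0"
  shows "Digamma (1 + u) = u * digamma_rem 0 u - euler_mascheroni"
proof -
  have "inverse (of_nat (Suc n)) - inverse (1 + u + of_nat n)
      = u * (1 / (real (Suc n) ^ (0 + 1) * (real (Suc n) + u)))" for n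
  proof -
    have "inverse a - inverse (a + u) = u * (1 / (a * (a + u)))" if "a > 0" for a
      using that assms by (simp add: field_simps)
    from this[of "real (Suc n)"] show ?thesis by (simp add: add_ac)
  qed
  then have "Digamma (1 + u)
      = (\<Sum>n. u * (1 / (real (Suc n) ^ (0 + 1) * (real (Suc n) + u)))) - euler_mascheroni"
    unfolding Digamma_def by simp
  then show ?thesis
    unfolding digamma_rem_def by (simp only: suminf_mult[OF summable_digamma_rem[OF assms]])
qed

text \<open>Iterating \<open>digamma_rem_Suc\<close> gives an exact finite identity, so the radius
  of convergence imposes no restriction and \<open>u = 1\<close> is covered.\<close>

lemma Digamma_Taylor:
  assumes "u \<ge> 0"
  shows "Digamma (1 + u) = - euler_mascheroni
    + (\<Sum>j<N. (-1) ^ j * zeta (real (j + 2)) * u ^ (j + 1)) + (-1) ^ N * u ^ (N + 1) * digamma_rem N u"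
proof (induction N)
  case 0
  show ?case using Digamma_conv_digamma_rem[OF assms] by simp
next
  case (Suc N)
  then show ?case using digamma_rem_Suc[OF assms, of N] by (simp add: algebra_simps)
qed

section \<open>Integration over the unit interval\<close>

lemma has_integral_power_0_1: "((\<lambda>u::real. u ^ n) has_integral 1 / real (n + 1)) {0..1}"
proof -
  have "((\<lambda>u. u ^ n) has_integral 1 ^ (n + 1) / real (n + 1) - 0 ^ (n + 1) / real (n + 1)) {0..1::real}"
    by (intro fundamental_theorem_of_calculus)
      (auto intro!: derivative_eq_intros
        simp: has_real_derivative_iff_has_vector_derivative [symmetric] simp del: of_nat_Suc power_Suc)
  then show ?thesis by simp
qed

lemma integrable_power_Digamma_plus1: "(\<lambda>u::real. u ^ m * Digamma (1 + u)) integrable_on {0..1}"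
  by (intro integrable_continuous_real continuous_intros continuous_on_compose2[OF
        continuous_on_Polygamma[of "{0<..}"]]) (auto elim!: nonpos_Ints_cases)

text \<open>Integrating the Taylor identity leaves an error of at most
  \<open>zeta 2 / (N + m + 2)\<close>, which yields convergence of the series together with its
  value.\<close>

lemma zeta_series_sums_integral:
  "(\<lambda>n. (-1) ^ (n + 2) / real (m + (n + 2)) * zeta (real (n + 2))) sums
    (integral {0..1} (\<lambda>u. u ^ m * Digamma (1 + u)) + euler_mascheroni / real (m + 1))"
proof -
  define I where "I = integral {0..1} (\<lambda>u::real. u ^ m * Digamma (1 + u))"
  define S where "S = (\<lambda>N. \<Sum>n<N. (-1) ^ (n + 2) / real (m + (n + 2)) * zeta (real (n + 2)))"
  have bound: "norm (S N - (I + euler_mascheroni / real (m + 1))) \<le> zeta 2 * (1 / real (N + m + 2))" for N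
  proof -
    \<comment> \<open>\<open>p\<close> is \<open>u ^ m\<close> times the Taylor polynomial, written
      in monomials so that it integrates term by term.\<close>
    define p where "p = (\<lambda>u. (- euler_mascheroni) * u ^ m
      + (\<Sum>j<N. ((-1) ^ j * zeta (real (j + 2))) * u ^ (m + (j + 1))))"
    have "(p has_integral (- euler_mascheroni) * (1 / real (m + 1))
        + (\<Sum>j<N. ((-1) ^ j * zeta (real (j + 2))) * (1 / real (m + (j + 1) + 1)))) {0..1}"
      unfolding p_def
      by (intro has_integral_add has_integral_sum has_integral_mult_right has_integral_power_0_1) auto
    moreover have "(\<Sum>j<N. ((-1) ^ j * zeta (real (j + 2))) * (1 / real (m + (j + 1) + 1))) = S N"
      unfolding S_def by (intro sum.cong) (auto simp: mult_ac add_ac)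
    ultimately have p: "(p has_integral S N - euler_mascheroni / real (m + 1)) {0..1}"
      by simp
    have "((\<lambda>u. p u - u ^ m * Digamma (1 + u)) has_integral
        S N - euler_mascheroni / real (m + 1) - I) {0..1}"
      unfolding I_def
      by (intro has_integral_diff p integrable_integral integrable_power_Digamma_plus1)
    moreover have "((\<lambda>u. zeta 2 * u ^ (N + m + 1)) has_integral zeta 2 * (1 / real (N + m + 1 + 1))) {0..1}"
      by (intro has_integral_mult_right has_integral_power_0_1)
    moreover have "norm (p u - u ^ m * Digamma (1 + u)) \<le> zeta 2 * u ^ (N + m + 1)"
      if "u \<in> {0..1}" for u
    proof -
      have u: "u \<ge> 0" using that by simp
      have "p u - u ^ m * Digamma (1 + u) = - ((-1) ^ N * (u ^ (N + m + 1) * digamma_rem N u))"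
        unfolding p_def Digamma_Taylor[OF u, of N]
        by (simp add: algebra_simps power_add sum_distrib_left)
      then have "norm (p u - u ^ m * Digamma (1 + u)) = u ^ (N + m + 1) * digamma_rem N u"
        using u digamma_rem_bounds(1)[OF u, of N] by (simp add: abs_mult power_abs)
      also have "\<dots> \<le> u ^ (N + m + 1) * zeta 2"
        using u by (intro mult_left_mono digamma_rem_bounds) auto
      finally show ?thesis by (simp add: mult_ac)
    qed
    ultimately have "norm (S N - euler_mascheroni / real (m + 1) - I)
        \<le> zeta 2 * (1 / real (N + m + 1 + 1))"
      by (metis (no_types, lifting) has_integral_iff integral_norm_bound_integral)
    then show ?thesis by (simp add: algebra_simps)
  qed
  have "(\<lambda>N. zeta 2 * (1 / real (N + m + 2))) \<longlonglongrightarrow> 0"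
    by real_asymp
  then have "(\<lambda>N. S N - (I + euler_mascheroni / real (m + 1))) \<longlonglongrightarrow> 0"
    by (rule Lim_null_comparison[rotated]) (use bound in auto)
  then show ?thesis unfolding sums_def S_def I_def by (simp add: LIM_zero_iff)
qed

text \<open>The recurrence \<open>Digamma (1 + u) = Digamma u + 1 / u\<close> turns the pole into
  \<open>u ^ (m - 1)\<close>, a genuine power because \<open>m \<ge> 1\<close>. It fails at
  \<open>u = 0\<close>, a negligible point.\<close>

lemma has_integral_power_Digamma:
  assumes "m \<ge> 1"
  shows "((\<lambda>u. u ^ m * Digamma u) has_integral
    integral {0..1} (\<lambda>u. u ^ m * Digamma (1 + u)) - 1 / real m) {0..1}"
proof (rule has_integral_spike_finite[of "{0}"])
  have "((\<lambda>u. u ^ m * Digamma (1 + u) - u ^ (m - 1)) has_integral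
    integral {0..1} (\<lambda>u. u ^ m * Digamma (1 + u)) - 1 / real (m - 1 + 1)) {0..1}"
    by (intro has_integral_diff integrable_integral integrable_power_Digamma_plus1 has_integral_power_0_1)
  then show "((\<lambda>u. u ^ m * Digamma (1 + u) - u ^ (m - 1)) has_integral
    integral {0..1} (\<lambda>u. u ^ m * Digamma (1 + u)) - 1 / real m) {0..1}"
    using assms by simp
  show "u ^ m * Digamma u = u ^ m * Digamma (1 + u) - u ^ (m - 1)" if "u \<in> {0..1} - {0::real}" for u
    using that assms Digamma_plus1[of u]
    by (cases m) (auto simp: add.commute algebra_simps)
qed simp

theorem theorem3p1:
  fixes k :: real and m :: nat
  assumes "k > 0" and "m \<ge> 1"
  shows "(\<lambda>x. x ^ m * Digamma_k k x) integrable_on {0..k}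
    \<and> summable (\<lambda>n. (-1) ^ (n + 2) / real (m + (n + 2)) * zeta (real (n + 2)))
    \<and> integral {0..k} (\<lambda>x. x ^ m * Digamma_k k x)
        = k ^ m * (ln k - euler_mascheroni) / real (m + 1) - k ^ m / real m
          + k ^ m * (\<Sum>n. (-1) ^ (n + 2) / real (m + (n + 2)) * zeta (real (n + 2)))"
proof -
  define S where "S = (\<Sum>n. (-1) ^ (n + 2) / real (m + (n + 2)) * zeta (real (n + 2)))"
  \<comment> \<open>\<open>J\<close> is the integral of \<open>u ^ m * (Digamma u + ln k)\<close>
    over \<open>{0..1}\<close>.\<close>
  define J where "J = S - euler_mascheroni / real (m + 1) - 1 / real m + ln k / real (m + 1)"
  have k: "k > 0" by fact
  have "((\<lambda>u. u ^ m * Digamma u) has_integral S - euler_mascheroni / real (m + 1) - 1 / real m) {0..1}"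
    using has_integral_power_Digamma[OF assms(2)]
    unfolding S_def sums_unique[OF zeta_series_sums_integral, symmetric] by simp
  then have "((\<lambda>u. u ^ m * Digamma u + ln k * u ^ m) has_integral
      S - euler_mascheroni / real (m + 1) - 1 / real m + ln k * (1 / real (m + 1))) {0..1}"
    by (intro has_integral_add has_integral_mult_right has_integral_power_0_1)
  then have "((\<lambda>u. u ^ m * Digamma u + ln k * u ^ m) has_integral J) {0..1}"
    by (simp add: J_def)
  from has_integral_stretch_real[OF this, of "1 / k"]
  have "((\<lambda>x. (x / k) ^ m * Digamma (x / k) + ln k * (x / k) ^ m) has_integral k * J) {0..k}"
    using k by (simp add: image_mult_atLeastAtMost mult.commute[of _ k])
  \<comment> \<open>The factor \<open>k ^ m\<close> turns \<open>(x / k) ^ m\<close> into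
    \<open>x ^ m\<close>; the division by \<open>k\<close> is the one in
    \<open>Digamma_k_conv_Digamma\<close>.\<close>
  then have "((\<lambda>x. k ^ m / k * ((x / k) ^ m * Digamma (x / k) + ln k * (x / k) ^ m))
      has_integral k ^ m / k * (k * J)) {0..k}"
    by (rule has_integral_mult_right)
  \<comment> \<open>The formula for \<open>Digamma_k\<close> requires \<open>x > 0\<close>, so the
    endpoint 0 is excepted.\<close>
  then have "((\<lambda>x. x ^ m * Digamma_k k x) has_integral k ^ m / k * (k * J)) {0..k}"
    by (rule has_integral_spike_finite[of "{0}", rotated 2])
      (use k in \<open>auto simp: Digamma_k_conv_Digamma field_simps\<close>)
  moreover have "k ^ m / k * (k * J)
      = k ^ m * (ln k - euler_mascheroni) / real (m + 1) - k ^ m / real m + k ^ m * S"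
    using k by (simp add: J_def diff_divide_distrib algebra_simps)
  ultimately show ?thesis
    using sums_summable[OF zeta_series_sums_integral[of m]]
    unfolding S_def by (auto simp: has_integral_iff)
qed

end
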